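(* For every integer $n\ge 2$ there exist a number $C_n>0$ and an integer $N_n$ such that every finite family $\mathcal F$ of lines in general position in $\mathbb{R}^2$ with $|\mathcal F|\ge N_n$ contains subfamilies $\mathcal F_1,\dots,\mathcal F_n\subset\mathcal F$, each of size at least $C_n|\mathcal F|$, such that every transversal of $\mathcal F_1,\dots,\mathcal F_n$ defines an $n$-cell.
   Context: A finite family of lines in $\mathbb{R}^2$ is in general position if no three lines are concurrent, no two are parallel, and no line is vertical. A family of $n\ge 2$ lines in general position defines an $n$-cell if some connected component $P$ of the complement of the union of these $n$ lines has the property that its boundary contains a segment (of positive length, possibly a half-line) from each of the $n$ lines; $P$ may be bounded or unbounded. Given families of lines $\mathcal F_1,\dots,\mathcal F_n$, a transversal is a set $\{a_1,\dots,a_n\}$ with $a_i\in\mathcal F_i$ for every $i$. (In order to define an $n$-cell, a transversal must consist of $n$ distinct lines.) *)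

theory Defs
  imports "HOL-Analysis.Analysis"
begin

definition is_line :: "(real^2) set \<Rightarrow> bool" where
  "is_line L \<longleftrightarrow> affine L \<and> aff_dim L = 1"

definition vertical :: "(real^2) set \<Rightarrow> bool" where
  "vertical L \<longleftrightarrow> (\<exists>c. L = {x. x $ 1 = c})"

text \<open>A family of lines is a set of lines, so its members are pairwise distinct.
  \<^const>\<open>affine_parallel\<close> is reflexive, hence the restriction to distinct lines.\<close>

definition general_position :: "(real^2) set set \<Rightarrow> bool" where
  "general_position \<F> \<longleftrightarrow>
     finite \<F> \<and> (\<forall>L\<in>\<F>. is_line L) \<and>
     (\<forall>L\<in>\<F>. \<forall>M\<in>\<F>. \<forall>K\<in>\<F>. L \<noteq> M \<and> M \<noteq> K \<and> L \<noteq> K \<longrightarrow> L \<inter> M \<inter> K = {}) \<and>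
     (\<forall>L\<in>\<F>. \<forall>M\<in>\<F>. L \<noteq> M \<longrightarrow> \<not> affine_parallel L M) \<and>
     (\<forall>L\<in>\<F>. \<not> vertical L)"

text \<open>A half-line in the boundary contains a nondegenerate closed segment, so asking for the
  latter covers both cases. The cell \<open>P\<close> may be unbounded.\<close>

definition defines_cell :: "nat \<Rightarrow> (real^2) set set \<Rightarrow> bool" where
  "defines_cell n \<A> \<longleftrightarrow>
     2 \<le> n \<and> card \<A> = n \<and> general_position \<A> \<and>
     (\<exists>P \<in> components (- \<Union>\<A>).
        \<forall>L\<in>\<A>. \<exists>a b. a \<noteq> b \<and> closed_segment a b \<subseteq> L \<inter> frontier P)"

text \<open>The chosen elements \<open>a i\<close> are not required to be distinct, so a transversal may
  have fewer than \<open>n\<close> elements; such a transversal does not define an \<open>n\<close>-cell.\<close>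

definition transversal :: "nat \<Rightarrow> (nat \<Rightarrow> 'a set) \<Rightarrow> 'a set \<Rightarrow> bool" where
  "transversal n G T \<longleftrightarrow> (\<exists>a. (\<forall>i\<in>{1..n}. a i \<in> G i) \<and> T = a ` {1..n})"

end

theory Submission
  imports Defs "HOL-Library.Ramsey"
begin

text \<open>A non-vertical line is the graph of an affine function, so the family is a set of affine functions
  with distinct slopes, and two of its members cross at a single abscissa. Suppose that for all lines
  \<open>L\<close>, \<open>M\<close>, \<open>K\<close> of increasing slope the crossing of \<open>L\<close> and \<open>M\<close> lies to the left of the crossing
  of \<open>M\<close> and \<open>K\<close>. Then each line is strictly above all others on some interval, so every line
  contributes an edge to the upper envelope, and the region above the envelope is a cell bounded by
  all the lines. If the crossings always come in the opposite order, the same holds for the lower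
  envelope. The sign \<open>\<sigma> = 1\<close> or \<open>\<sigma> = -1\<close> below selects the upper or the lower envelope
  (\<open>bending_family_defines_cell\<close>).

  It remains to find \<open>n\<close> large subfamilies for which the order of crossings is the same in all
  triples of lines from distinct subfamilies. Cut the family, ordered by slope, into a constant
  number \<open>M\<close> of blocks of equal size. For three blocks \<open>A\<close>, \<open>B\<close>, \<open>C\<close> of increasing slopes, halving
  each of them makes the order of crossings constant (\<open>halve_three_families\<close>). Indeed, at the far
  left the lines of \<open>A\<close> are above those of \<open>C\<close>, and at the far right below them; the median
  heights depend continuously on the abscissa, so they agree at some abscissa \<open>t\<close>, with value
  \<open>y\<close>. Half of \<open>B\<close> is on one side of \<open>y\<close> over \<open>t\<close>; take the halves of \<open>A\<close> and \<open>C\<close> on the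
  other side. If the half of \<open>B\<close> is above, then among the lines kept no crossing of \<open>A\<close> with \<open>B\<close> is
  to the right of \<open>t\<close> and no crossing of \<open>B\<close> with \<open>C\<close> is to the left of it; if it is below, the
  other way round. Lines in general position have no three concurrent, so the two crossings are
  then in strict order.

  Applying this to each triple of blocks in turn costs a factor that depends on \<open>M\<close> alone
  (\<open>refine_triples\<close>). The order of crossings then colours the triples of blocks with two colours, and
  by Ramsey's theorem \<open>n\<close> of the blocks span a single colour, if \<open>M\<close> was chosen large enough.\<close>

section \<open>Non-vertical lines as graphs\<close>

text \<open>Slope and intercept. For a non-vertical line they exist and the choice is unique; for any other set
  the value is arbitrary.\<close>

definition line_coeffs :: "(real^2) set \<Rightarrow> real \<times> real" where
  "line_coeffs L = (SOME p. L = {z. z$2 = fst p * z$1 + snd p})"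

definition slope :: "(real^2) set \<Rightarrow> real" where
  "slope L = fst (line_coeffs L)"

definition height :: "(real^2) set \<Rightarrow> real \<Rightarrow> real" where
  "height L t = slope L * t + snd (line_coeffs L)"

definition cross_abscissa :: "(real^2) set \<Rightarrow> (real^2) set \<Rightarrow> real" where
  "cross_abscissa L M = (snd (line_coeffs M) - snd (line_coeffs L)) / (slope L - slope M)"

lemma cross_abscissa_commute: "cross_abscissa L M = cross_abscissa M L"
  unfolding cross_abscissa_def by (simp add: divide_simps) (simp add: algebra_simps)

lemma height_diff:
  assumes "slope L \<noteq> slope M"
  shows "height L t - height M t = (slope L - slope M) * (t - cross_abscissa L M)"
  using assms unfolding cross_abscissa_def height_def by (simp add: field_simps)

lemma continuous_on_height [continuous_intros]: "continuous_on S (height L)"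
  unfolding height_def by (intro continuous_intros)

lemma nonvertical_line_eq_graph:
  assumes "is_line L" "\<not> vertical L"
  shows "L = {z. z$2 = height L (z$1)}"
proof -
  have "aff_dim L = int (DIM(real^2) - 1)" and hull: "affine hull L = L"
    using assms(1) by (auto simp: is_line_def)
  from aff_dim_eq_hyperplane[THEN iffD1, OF this(1)] hull
  obtain a b where a: "a \<noteq> 0" and L: "L = {x. a \<bullet> x = b}"
    by auto
  have L2: "L = {x. a$1 * x$1 + a$2 * x$2 = b}"
    unfolding L by (simp add: inner_vec_def sum_2)
  have "a$2 \<noteq> 0"
  proof
    assume 0: "a$2 = 0"
    then have "a$1 \<noteq> 0"
      using a by (auto simp: vec_eq_iff forall_2)
    then have "L = {x. x$1 = b / a$1}"
      unfolding L2 using 0 by (auto simp: field_simps)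
    with assms(2) show False
      unfolding vertical_def by blast
  qed
  then have "L = {z. z$2 = fst (- a$1 / a$2, b / a$2) * z$1 + snd (- a$1 / a$2, b / a$2)}"
    unfolding L2 by (auto simp: field_simps)
  then have "L = {z. z$2 = fst (line_coeffs L) * z$1 + snd (line_coeffs L)}"
    unfolding line_coeffs_def by (rule someI)
  then show ?thesis
    unfolding height_def slope_def .
qed

lemma general_positionD:
  assumes "general_position \<F>"
  shows "finite \<F>"
    and "L \<in> \<F> \<Longrightarrow> is_line L"
    and "L \<in> \<F> \<Longrightarrow> \<not> vertical L"
    and "L \<in> \<F> \<Longrightarrow> M \<in> \<F> \<Longrightarrow> L \<noteq> M \<Longrightarrow> \<not> affine_parallel L M"
    and "L \<in> \<F> \<Longrightarrow> M \<in> \<F> \<Longrightarrow> K \<in> \<F> \<Longrightarrow> L \<noteq> M \<Longrightarrow> M \<noteq> K \<Longrightarrow> L \<noteq> K \<Longrightarrow> L \<inter> M \<inter> K = {}"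
  using assms unfolding general_position_def by simp_all

lemma general_position_graph:
  assumes "general_position \<F>" "L \<in> \<F>"
  shows "z \<in> L \<longleftrightarrow> z$2 = height L (z$1)"
  using nonvertical_line_eq_graph[OF general_positionD(2,3)[OF assms]] by blast

text \<open>Two distinct lines of equal slope would be vertical translates of each other, hence parallel.\<close>

lemma general_position_slopes:
  assumes "general_position \<F>"
  shows "inj_on slope \<F>"
proof (rule inj_onI, rule ccontr)
  fix L M assume LM: "L \<in> \<F>" "M \<in> \<F>" "slope L = slope M" "L \<noteq> M"
  define d where "d = height M 0 - height L 0"
  have d: "height M t = height L t + d" for t
    using LM(3) unfolding d_def height_def by simp
  have "M = (+) (vector [0, d] :: real^2) ` L"
  proof (intro set_eqI iffI)
    fix z assume "z \<in> M"
    then have "z - vector [0, d] \<in> L"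
      using general_position_graph[OF assms] LM d by auto
    then show "z \<in> (+) (vector [0, d]) ` L"
      by (metis add.commute diff_add_cancel image_eqI)
  next
    fix z assume "z \<in> (+) (vector [0, d] :: real^2) ` L"
    then show "z \<in> M"
      using general_position_graph[OF assms] LM d by auto
  qed
  then have "affine_parallel L M"
    unfolding affine_parallel_def by blast
  then show False
    using general_positionD(4)[OF assms] LM by simp
qed

lemma general_position_subset:
  assumes "general_position \<F>" "\<A> \<subseteq> \<F>"
  shows "general_position \<A>"
proof -
  have "finite \<A>"
    using finite_subset[OF assms(2) general_positionD(1)[OF assms(1)]] .
  then show ?thesis
    using assms(1) subsetD[OF assms(2)] unfolding general_position_def by simp
qed

text \<open>If the two crossings had the same abscissa, they would both be the point of \<open>M\<close> above it, and the
  three lines would be concurrent.\<close>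

lemma general_position_cross_neq:
  assumes gp: "general_position \<F>" and mem: "L \<in> \<F>" "M \<in> \<F>" "K \<in> \<F>"
    and neq: "L \<noteq> M" "M \<noteq> K" "L \<noteq> K"
  shows "cross_abscissa L M \<noteq> cross_abscissa M K"
proof
  define t where "t = cross_abscissa M K"
  assume "cross_abscissa L M = cross_abscissa M K"
  then have t: "t = cross_abscissa L M" "t = cross_abscissa M K"
    by (auto simp: t_def)
  have "slope L \<noteq> slope M" "slope M \<noteq> slope K"
    using general_position_slopes[OF gp] mem neq by (auto dest: inj_onD)
  then have "height L t = height M t" "height M t = height K t"
    using height_diff[of L M t] height_diff[of M K t] t by auto
  then have "(vector [t, height M t] :: real^2) \<in> L \<inter> M \<inter> K"
    using general_position_graph[OF gp] mem by auto
  moreover have "L \<inter> M \<inter> K = {}"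
    by (rule general_positionD(5)[OF gp mem neq])
  ultimately show False by blast
qed

section \<open>Envelopes are cells\<close>

text \<open>For lines \<open>L\<close>, \<open>M\<close>, \<open>K\<close> of increasing slope and \<open>\<sigma> = 1\<close> (or \<open>\<sigma> = -1\<close>) this says that the
  middle line \<open>M\<close> reaches the upper (or lower) envelope of the three. The inequality is not strict so
  that medians can establish it; general position makes it strict
  (\<open>general_position_cross_neq\<close>).\<close>

definition bends :: "real \<Rightarrow> (real^2) set \<Rightarrow> (real^2) set \<Rightarrow> (real^2) set \<Rightarrow> bool" where
  "bends \<sigma> L M K \<longleftrightarrow> \<sigma> * cross_abscissa L M \<le> \<sigma> * cross_abscissa M K"

lemma finite_sets_gap:
  fixes U V :: "real set"
  assumes "finite U" "finite V" "\<And>u v. u \<in> U \<Longrightarrow> v \<in> V \<Longrightarrow> u < v"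
  obtains p q where "p < q" "\<And>u. u \<in> U \<Longrightarrow> u \<le> p" "\<And>v. v \<in> V \<Longrightarrow> q \<le> v"
proof (cases "U = {}")
  case True
  define q where "q = Min (insert 0 V)"
  have "q \<le> v" if "v \<in> V" for v
    unfolding q_def using assms(2) that by (intro Min_le) auto
  then show ?thesis
    using that[of "q - 1" q] True by simp
next
  case False
  define p where "p = Max U"
  define q where "q = Min (insert (p + 1) V)"
  have "p \<in> U"
    unfolding p_def using assms(1) False by (rule Max_in)
  then have "p < q"
    unfolding q_def using assms(2,3) by simp
  moreover have "u \<le> p" if "u \<in> U" for u
    unfolding p_def using assms(1) that by (intro Max_ge)
  moreover have "q \<le> v" if "v \<in> V" for v
    unfolding q_def using assms(2) that by (intro Min_le) auto
  ultimately show ?thesis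
    using that[of p q] by blast
qed

text \<open>The crossings with flatter lines and those with steeper lines are separated by an interval, and
  over that interval \<open>L\<close> is extreme. The abscissae are written \<open>\<sigma> * p\<close> and \<open>\<sigma> * q\<close> because for
  \<open>\<sigma> = -1\<close> the crossings with steeper lines come first, and scaling by \<open>\<sigma>\<close> restores the order.\<close>

lemma envelope_interval:
  assumes gp: "general_position \<A>" and L: "L \<in> \<A>" and \<sigma>: "\<bar>\<sigma>\<bar> = 1"
    and bends: "\<And>M K. M \<in> \<A> \<Longrightarrow> K \<in> \<A> \<Longrightarrow> slope M < slope L \<Longrightarrow> slope L < slope K
                  \<Longrightarrow> bends \<sigma> M L K"
  obtains p q where "p < q"
    "\<And>M. M \<in> \<A> \<Longrightarrow> \<sigma> * height M (\<sigma> * p) \<le> \<sigma> * height L (\<sigma> * p)"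
    "\<And>M. M \<in> \<A> \<Longrightarrow> \<sigma> * height M (\<sigma> * q) \<le> \<sigma> * height L (\<sigma> * q)"
proof -
  have fin: "finite \<A>"
    by (rule general_positionD(1)[OF gp])
  have \<sigma>2: "\<sigma> * \<sigma> = 1"
    using \<sigma> by (metis abs_mult_self_eq mult_1)
  \<comment> \<open>\<open>L\<close> beats a flatter line beyond their crossing, and a steeper line before it, after scaling
    the abscissae by \<open>\<sigma>\<close>.\<close>
  define U where "U = (\<lambda>M. \<sigma> * cross_abscissa M L) ` {M \<in> \<A>. slope M < slope L}"
  define V where "V = (\<lambda>K. \<sigma> * cross_abscissa L K) ` {K \<in> \<A>. slope L < slope K}"
  have lt: "u < v" if "u \<in> U" "v \<in> V" for u v
  proof -
    from that obtain M K where MK: "M \<in> \<A>" "slope M < slope L" "K \<in> \<A>" "slope L < slope K"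
      and uv: "u = \<sigma> * cross_abscissa M L" "v = \<sigma> * cross_abscissa L K"
      unfolding U_def V_def by auto
    have "u \<le> v"
      using bends MK uv unfolding bends_def by blast
    moreover have "M \<noteq> L" "L \<noteq> K" "M \<noteq> K"
      using MK by auto
    then have "cross_abscissa M L \<noteq> cross_abscissa L K"
      by (rule general_position_cross_neq[OF gp MK(1) L MK(3)])
    then have "u \<noteq> v"
      using uv \<sigma> by auto
    ultimately show ?thesis by simp
  qed
  have "finite U" "finite V"
    unfolding U_def V_def using fin by auto
  then obtain p q where pq: "p < q" and p: "\<And>u. u \<in> U \<Longrightarrow> u \<le> p" and q: "\<And>v. v \<in> V \<Longrightarrow> q \<le> v"
    using lt by (metis finite_sets_gap)
  have below: "\<sigma> * height M (\<sigma> * r) \<le> \<sigma> * height L (\<sigma> * r)" if M: "M \<in> \<A>" and r: "p \<le> r" "r \<le> q" for M r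
  proof (cases "M = L")
    case False
    then have "slope L \<noteq> slope M"
      using general_position_slopes[OF gp] L M by (auto dest: inj_onD)
    then have "\<sigma> * (height L (\<sigma> * r) - height M (\<sigma> * r))
        = (slope L - slope M) * ((\<sigma> * \<sigma>) * r - \<sigma> * cross_abscissa L M)"
      by (simp add: height_diff algebra_simps)
    also have "\<dots> = (slope L - slope M) * (r - \<sigma> * cross_abscissa L M)"
      by (simp add: \<sigma>2)
    also have "\<dots> \<ge> 0"
    proof (cases "slope M < slope L")
      case True
      then have "\<sigma> * cross_abscissa L M \<le> r"
        using p[of "\<sigma> * cross_abscissa L M"] M r cross_abscissa_commute[of L M]
        unfolding U_def by fastforce
      with True show ?thesis by simp
    next
      case False
      with \<open>slope L \<noteq> slope M\<close> have "slope L < slope M" by simp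
      then have "r \<le> \<sigma> * cross_abscissa L M"
        using q[of "\<sigma> * cross_abscissa L M"] M r unfolding V_def by fastforce
      with \<open>slope L < slope M\<close> show ?thesis
        by (simp add: mult_nonpos_nonpos)
    qed
    finally show ?thesis by (simp add: algebra_simps)
  qed simp
  show ?thesis
    using that[of p q] pq below by auto
qed

text \<open>The region beyond the envelope is an intersection of half-planes, hence connected. On its
  boundary one of the defining strict inequalities is an equality, so the boundary lies on the lines
  and no larger connected set avoids them.\<close>

lemma envelope_region_component:
  fixes \<sigma> :: real
  assumes gp: "general_position \<A>" and \<sigma>: "\<bar>\<sigma>\<bar> = 1"
  defines "P \<equiv> {z :: real^2. \<forall>L\<in>\<A>. \<sigma> * height L (z$1) < \<sigma> * z$2}"
  shows "P \<in> components (- \<Union>\<A>)" "open P"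
proof -
  have fin: "finite \<A>"
    by (rule general_positionD(1)[OF gp])
  have Peq: "P = (\<Inter>L\<in>\<A>. {z. \<sigma> * height L (z$1) < \<sigma> * z$2})"
    unfolding P_def by auto
  have halfplane: "{z :: real^2. \<sigma> * height L (z$1) < \<sigma> * z$2} = 
      {z. (vector [\<sigma> * slope L, - \<sigma>] :: real^2) \<bullet> z < - \<sigma> * snd (line_coeffs L)}" for L
    unfolding height_def by (auto simp: inner_vec_def sum_2 algebra_simps)
  have "convex P"
    unfolding Peq halfplane by (intro convex_INT convex_halfspace_lt)
  show "open P"
    unfolding Peq halfplane using fin by (intro open_INT) (auto intro: open_halfspace_lt)
  have PsubC: "P \<subseteq> - \<Union>\<A>"
    using general_position_graph[OF gp] unfolding P_def by fastforce
  have front: "frontier P \<subseteq> \<Union>\<A>"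
  proof
    fix z assume z: "z \<in> frontier P"
    have cl: "z \<in> closure P" and nP: "z \<notin> P"
      using z \<open>open P\<close> by (auto simp: frontier_def interior_open)
    have "closed {z :: real^2. \<sigma> * height L (z$1) \<le> \<sigma> * z$2}" for L
      unfolding height_def by (intro closed_Collect_le continuous_intros)
    then have "closure P \<subseteq> {z. \<sigma> * height L (z$1) \<le> \<sigma> * z$2}" if "L \<in> \<A>" for L
      using that by (intro closure_minimal) (auto simp: P_def less_imp_le)
    moreover obtain L where L: "L \<in> \<A>" "\<not> \<sigma> * height L (z$1) < \<sigma> * z$2"
      using nP unfolding P_def by blast
    ultimately have "\<sigma> * height L (z$1) = \<sigma> * z$2"
      using cl by fastforce
    then have "z$2 = height L (z$1)"
      using \<sigma> by auto
    then have "z \<in> L"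
      by (rule general_position_graph[OF gp L(1), THEN iffD2])
    with L(1) show "z \<in> \<Union>\<A>" by blast
  qed
  have "P \<noteq> {}"
  proof -
    define y where "y = Max (insert 0 ((\<lambda>L. \<sigma> * height L 0) ` \<A>)) + 1"
    have "\<sigma> * height L 0 < y" if "L \<in> \<A>" for L
    proof -
      have "\<sigma> * height L 0 \<le> Max (insert 0 ((\<lambda>L. \<sigma> * height L 0) ` \<A>))"
        using fin that by (intro Max_ge) auto
      then show ?thesis unfolding y_def by simp
    qed
    moreover have "\<sigma> * (\<sigma> * y) = y"
      using \<sigma> by (metis abs_mult_self_eq mult.assoc mult_1)
    ultimately have "(vector [0, \<sigma> * y] :: real^2) \<in> P"
      unfolding P_def by (simp only: mem_Collect_eq vector_2) blast
    then show ?thesis by blast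
  qed
  moreover have "connected P"
    using \<open>convex P\<close> by (rule convex_connected)
  moreover have "D = P" if "D \<noteq> {}" "P \<subseteq> D" "D \<subseteq> - \<Union>\<A>" "connected D" for D
  proof (rule ccontr)
    assume "D \<noteq> P"
    then have "D \<inter> P \<noteq> {}" "D - P \<noteq> {}"
      using \<open>P \<noteq> {}\<close> that by auto
    then have "D \<inter> frontier P \<noteq> {}"
      by (rule connected_Int_frontier[OF \<open>connected D\<close>])
    with front that show False by auto
  qed
  ultimately show "P \<in> components (- \<Union>\<A>)"
    unfolding in_components_maximal using PsubC by simp
qed

lemma bending_family_defines_cell:
  assumes gp: "general_position \<A>" and two: "2 \<le> card \<A>" and \<sigma>: "\<bar>\<sigma>\<bar> = 1"
    and bends: "\<And>L M K. L \<in> \<A> \<Longrightarrow> M \<in> \<A> \<Longrightarrow> K \<in> \<A> \<Longrightarrow> slope L < slope M \<Longrightarrow> slope M < slope K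
                  \<Longrightarrow> bends \<sigma> L M K"
  shows "defines_cell (card \<A>) \<A>"
proof -
  define P where "P = {z :: real^2. \<forall>L\<in>\<A>. \<sigma> * height L (z$1) < \<sigma> * z$2}"
  have comp: "P \<in> components (- \<Union>\<A>)" and "open P"
    using envelope_region_component[OF gp \<sigma>] unfolding P_def by auto
  have \<sigma>2: "\<sigma> * \<sigma> = 1"
    using \<sigma> by (metis abs_mult_self_eq mult_1)
  have "\<exists>a b. a \<noteq> b \<and> closed_segment a b \<subseteq> L \<inter> frontier P" if L: "L \<in> \<A>" for L
  proof -
    obtain p q where pq: "p < q"
      and p: "\<And>M. M \<in> \<A> \<Longrightarrow> \<sigma> * height M (\<sigma> * p) \<le> \<sigma> * height L (\<sigma> * p)"
      and q: "\<And>M. M \<in> \<A> \<Longrightarrow> \<sigma> * height M (\<sigma> * q) \<le> \<sigma> * height L (\<sigma> * q)"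
      using envelope_interval[OF gp L \<sigma>] bends L by metis
    \<comment> \<open>\<open>S\<close> is the part of \<open>L\<close> on the envelope. It is convex, so it suffices to find two points
      of it.\<close>
    define S where "S = {z :: real^2. \<forall>M\<in>\<A>. z$2 = height L (z$1) \<and> \<sigma> * height M (z$1) \<le> \<sigma> * z$2}"
    define a b :: "real^2" where "a = vector [\<sigma> * p, height L (\<sigma> * p)]"
      and "b = vector [\<sigma> * q, height L (\<sigma> * q)]"
    have "a$1 \<noteq> b$1"
      using pq \<sigma> unfolding a_def b_def by auto
    then have "a \<noteq> b" by auto
    have SL: "S \<subseteq> L"
      using general_position_graph[OF gp L] L unfolding S_def by blast
    have halfplanes: "S = (\<Inter>M\<in>\<A>. {z. (vector [slope L, -1] :: real^2) \<bullet> z = - snd (line_coeffs L)} \<inter>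
       {z. (vector [\<sigma> * slope M, - \<sigma>] :: real^2) \<bullet> z \<le> - \<sigma> * snd (line_coeffs M)})"
      unfolding S_def height_def by (auto simp: inner_vec_def sum_2 algebra_simps)
    have "convex S"
      unfolding halfplanes by (intro convex_INT convex_Int convex_halfspace_le convex_hyperplane)
    moreover have "a \<in> S" "b \<in> S"
      using p q unfolding S_def a_def b_def by auto
    ultimately have "closed_segment a b \<subseteq> S"
      by (rule closed_segment_subset[rotated 2])
    moreover have "S \<subseteq> frontier P"
    proof
      fix z assume z: "z \<in> S"
      have "z \<notin> P"
        using z L unfolding S_def P_def by auto
      moreover have "z \<in> closure P"
      proof (rule closure_sequential[THEN iffD2], intro exI conjI allI)
        \<comment> \<open>A point of the envelope becomes a point of \<open>P\<close> when pushed outwards vertically.\<close>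
        define w where "w n = z + (1 / real (Suc n)) *\<^sub>R (vector [0, \<sigma>] :: real^2)" for n
        show "w n \<in> P" for n
        proof -
          have "\<sigma> * (w n)$2 = \<sigma> * z$2 + 1 / real (Suc n)"
            unfolding w_def using \<sigma>2 by (simp add: algebra_simps)
          then have "\<sigma> * z$2 < \<sigma> * (w n)$2" by simp
          moreover have "(w n)$1 = z$1"
            unfolding w_def by simp
          ultimately show ?thesis
            using z unfolding P_def S_def by fastforce
        qed
        have "w \<longlonglongrightarrow> z + 0 *\<^sub>R vector [0, \<sigma>]"
          unfolding w_def using LIMSEQ_inverse_real_of_nat
          by (intro tendsto_intros) (simp add: inverse_eq_divide)
        then show "w \<longlonglongrightarrow> z" by simp
      qed
      ultimately show "z \<in> frontier P"
        using \<open>open P\<close> by (simp add: frontier_def interior_open)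
    qed
    ultimately have "closed_segment a b \<subseteq> L \<inter> frontier P"
      using SL by blast
    with \<open>a \<noteq> b\<close> show ?thesis by blast
  qed
  with comp gp two show ?thesis
    unfolding defines_cell_def by blast
qed

section \<open>Medians vary continuously\<close>

lemma continuous_on_Max_image:
  fixes f :: "'a \<Rightarrow> 'b::topological_space \<Rightarrow> real"
  assumes "finite A" "A \<noteq> {}" "\<And>a. a \<in> A \<Longrightarrow> continuous_on S (f a)"
  shows "continuous_on S (\<lambda>t. Max ((\<lambda>a. f a t) ` A))"
  using assms
proof (induction A rule: finite_ne_induct)
  case (insert a A)
  then show ?case by (simp add: continuous_on_max)
qed simp

lemma continuous_on_Min_image:
  fixes f :: "'a \<Rightarrow> 'b::topological_space \<Rightarrow> real"
  assumes "finite A" "A \<noteq> {}" "\<And>a. a \<in> A \<Longrightarrow> continuous_on S (f a)"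
  shows "continuous_on S (\<lambda>t. Min ((\<lambda>a. f a t) ` A))"
  using assms
proof (induction A rule: finite_ne_induct)
  case (insert a A)
  then show ?case by (simp add: continuous_on_min)
qed simp

text \<open>The \<open>k\<close>-th smallest value is the minimum over all \<open>k\<close>-element subsets of their maximum. Finite
  minima and maxima of continuous functions are continuous.\<close>

lemma continuous_median:
  fixes f :: "'a \<Rightarrow> 'b::topological_space \<Rightarrow> real"
  assumes A: "finite A" "A \<noteq> {}" and cont: "\<And>a. a \<in> A \<Longrightarrow> continuous_on S (f a)"
  obtains m where "continuous_on S m"
    "\<And>t. card A \<le> 2 * card {a \<in> A. f a t \<le> m t}"
    "\<And>t. card A \<le> 2 * card {a \<in> A. m t \<le> f a t}"
proof -
  \<comment> \<open>Rounding up makes both the values up to the \<open>k\<close>-th and those from the \<open>k\<close>-th on at least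
    half of all values.\<close>
  define k where "k = (card A + 1) div 2"
  define \<B> where "\<B> = {B. B \<subseteq> A \<and> card B = k}"
  define m where "m = (\<lambda>t. Min ((\<lambda>B. Max ((\<lambda>a. f a t) ` B)) ` \<B>))"
  have "card A > 0" using A by (simp add: card_gt_0_iff)
  then have k: "0 < k" "k \<le> card A" "card A \<le> 2 * k"
    unfolding k_def by auto
  have fin: "finite \<B>"
    unfolding \<B>_def using A by simp
  have ne: "\<B> \<noteq> {}"
    using obtain_subset_with_card_n[OF k(2)] unfolding \<B>_def by blast
  have B: "finite B" "B \<noteq> {}" "B \<subseteq> A" if "B \<in> \<B>" for B
    using that k A finite_subset unfolding \<B>_def by auto
  show ?thesis
  proof
    show "continuous_on S m"
      unfolding m_def using fin ne B cont
      by (intro continuous_on_Min_image continuous_on_Max_image) (auto simp: subset_iff)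
  next
    fix t
    have "m t \<in> (\<lambda>B. Max ((\<lambda>a. f a t) ` B)) ` \<B>"
      unfolding m_def using fin ne by (intro Min_in) auto
    then obtain B0 where B0: "B0 \<in> \<B>" "m t = Max ((\<lambda>a. f a t) ` B0)" by blast
    then have "B0 \<subseteq> {a \<in> A. f a t \<le> m t}"
      using B[of B0] by auto
    then have "card B0 \<le> card {a \<in> A. f a t \<le> m t}"
      using A by (intro card_mono) auto
    with B0 k show "card A \<le> 2 * card {a \<in> A. f a t \<le> m t}"
      unfolding \<B>_def by simp
  next
    fix t
    have "card {a \<in> A. f a t < m t} < k"
    proof (rule ccontr)
      assume "\<not> ?thesis"
      then have "k \<le> card {a \<in> A. f a t < m t}" by simp
      then obtain B1 where B1: "B1 \<subseteq> {a \<in> A. f a t < m t}" "card B1 = k"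
        using obtain_subset_with_card_n by blast
      then have mem: "B1 \<in> \<B>"
        unfolding \<B>_def by auto
      have "Max ((\<lambda>a. f a t) ` B1) < m t"
        using B[OF mem] B1 by auto
      moreover have "m t \<le> Max ((\<lambda>a. f a t) ` B1)"
        unfolding m_def using fin mem by (intro Min_le) auto
      ultimately show False by simp
    qed
    moreover have "card {a \<in> A. f a t < m t} + card {a \<in> A. m t \<le> f a t} = card A"
      using A by (subst card_Un_disjoint[symmetric]) (auto intro: arg_cong[where f = card])
    ultimately show "card A \<le> 2 * card {a \<in> A. m t \<le> f a t}"
      unfolding k_def by linarith
  qed
qed

section \<open>Order of crossings in three families\<close>

lemma height_le_iff:
  assumes "slope L < slope M"
  shows "height L t \<le> height M t \<longleftrightarrow> cross_abscissa L M \<le> t"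
    and "height M t \<le> height L t \<longleftrightarrow> t \<le> cross_abscissa L M"
proof -
  have *: "height M t - height L t = (slope M - slope L) * (t - cross_abscissa L M)"
    using height_diff[of M L t] assms cross_abscissa_commute[of L M] by simp
  have "0 \<le> height M t - height L t \<longleftrightarrow> cross_abscissa L M \<le> t"
    unfolding * using assms by (simp add: zero_le_mult_iff)
  then show "height L t \<le> height M t \<longleftrightarrow> cross_abscissa L M \<le> t" by simp
  have "height M t - height L t \<le> 0 \<longleftrightarrow> t \<le> cross_abscissa L M"
    unfolding * using assms by (simp add: mult_le_0_iff)
  then show "height M t \<le> height L t \<longleftrightarrow> t \<le> cross_abscissa L M" by simp
qed

text \<open>To the left of all crossings between \<open>A\<close> and \<open>C\<close> the median of \<open>A\<close> is above that of \<open>C\<close>, and to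
  the right of all of them it is below, so the medians meet in between.\<close>

lemma common_median:
  assumes A: "finite A" "A \<noteq> {}" and C: "finite C" "C \<noteq> {}"
    and slopes: "\<And>a c. a \<in> A \<Longrightarrow> c \<in> C \<Longrightarrow> slope a < slope c"
  obtains t y where
    "card A \<le> 2 * card {a \<in> A. height a t \<le> y}" "card A \<le> 2 * card {a \<in> A. y \<le> height a t}"
    "card C \<le> 2 * card {c \<in> C. height c t \<le> y}" "card C \<le> 2 * card {c \<in> C. y \<le> height c t}"
proof -
  obtain m where m: "continuous_on UNIV m"
    "\<And>t. card A \<le> 2 * card {a \<in> A. height a t \<le> m t}"
    "\<And>t. card A \<le> 2 * card {a \<in> A. m t \<le> height a t}"
    by (rule continuous_median[of A UNIV height, OF A continuous_on_height]) blast
  obtain l where l: "continuous_on UNIV l"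
    "\<And>t. card C \<le> 2 * card {a \<in> C. height a t \<le> l t}"
    "\<And>t. card C \<le> 2 * card {a \<in> C. l t \<le> height a t}"
    by (rule continuous_median[of C UNIV height, OF C continuous_on_height]) blast
  have pos: "0 < card A" "0 < card C"
    using A C by (auto simp: card_gt_0_iff)
  define X where "X = (\<lambda>(a, c). cross_abscissa a c) ` (A \<times> C)"
  have X: "finite X" "X \<noteq> {}"
    unfolding X_def using A C by auto
  have cross: "Min X \<le> cross_abscissa a c" "cross_abscissa a c \<le> Max X" if "a \<in> A" "c \<in> C" for a c
  proof -
    have "cross_abscissa a c \<in> X"
      unfolding X_def using that by force
    then show "Min X \<le> cross_abscissa a c" "cross_abscissa a c \<le> Max X"
      using X by auto
  qed
  have nonempty: "\<exists>x\<in>Z. Q x" if "card Z \<le> 2 * card {x \<in> Z. Q x}" "0 < card Z"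
    for Z :: "(real^2) set set" and Q
  proof (rule ccontr)
    assume "\<not> ?thesis"
    then have empty: "{x \<in> Z. Q x} = {}" by blast
    show False using that unfolding empty by simp
  qed
  have "l (Min X) - m (Min X) \<le> 0"
  proof -
    obtain a c where "a \<in> A" "height a (Min X) \<le> m (Min X)" "c \<in> C" "l (Min X) \<le> height c (Min X)"
      using nonempty[OF m(2) pos(1)] nonempty[OF l(3) pos(2)] by metis
    moreover from this have "height c (Min X) \<le> height a (Min X)"
      using height_le_iff(2)[of a c] slopes cross(1) by blast
    ultimately show ?thesis by linarith
  qed
  moreover have "0 \<le> l (Max X) - m (Max X)"
  proof -
    obtain a c where "a \<in> A" "m (Max X) \<le> height a (Max X)" "c \<in> C" "height c (Max X) \<le> l (Max X)"
      using nonempty[OF m(3) pos(1)] nonempty[OF l(2) pos(2)] by metis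
    moreover from this have "height a (Max X) \<le> height c (Max X)"
      using height_le_iff(1)[of a c] slopes cross(2) by blast
    ultimately show ?thesis by linarith
  qed
  moreover have "Min X \<le> Max X"
    using X by (metis Max_ge Min_in)
  moreover have "continuous_on {Min X..Max X} (\<lambda>t. l t - m t)"
    by (intro continuous_on_diff continuous_on_subset[OF l(1)] continuous_on_subset[OF m(1)]) auto
  ultimately obtain t where "l t - m t = 0"
    using IVT'[of "\<lambda>t. l t - m t" "Min X" 0 "Max X"] by blast
  then have "l t = m t" by simp
  then show ?thesis
    using that[of t "m t"] m(2,3)[of t] l(2,3)[of t] by simp
qed

definition homogeneous :: "(real^2) set set \<Rightarrow> (real^2) set set \<Rightarrow> (real^2) set set \<Rightarrow> bool" where
  "homogeneous A B C \<longleftrightarrow> (\<exists>\<sigma>\<in>{1, -1}. \<forall>a\<in>A. \<forall>b\<in>B. \<forall>c\<in>C. bends \<sigma> a b c)"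

lemma homogeneous_subset:
  assumes "homogeneous A B C" "A' \<subseteq> A" "B' \<subseteq> B" "C' \<subseteq> C"
  shows "homogeneous A' B' C'"
proof -
  obtain \<sigma> where "\<sigma> \<in> {1, -1}" "\<forall>a\<in>A. \<forall>b\<in>B. \<forall>c\<in>C. bends \<sigma> a b c"
    using assms(1) unfolding homogeneous_def by blast
  then show ?thesis
    unfolding homogeneous_def by (intro bexI[of _ \<sigma>] ballI) (use assms(2-4) in blast)+
qed

text \<open>At an abscissa \<open>t\<close> where the medians of \<open>A\<close> and \<open>C\<close> have the common height \<open>y\<close>, the majority side
  of \<open>B\<close> decides which halves to keep: \<open>B'\<close> on one side of \<open>y\<close>, and \<open>A'\<close> and \<open>C'\<close> on the other.
  All crossings of \<open>A'\<close> with \<open>B'\<close> are then separated by \<open>t\<close> from those of \<open>B'\<close> with \<open>C'\<close>.\<close>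

lemma halve_three_families:
  assumes fin: "finite A" "finite B" "finite C"
    and AB: "\<And>a b. a \<in> A \<Longrightarrow> b \<in> B \<Longrightarrow> slope a < slope b"
    and BC: "\<And>b c. b \<in> B \<Longrightarrow> c \<in> C \<Longrightarrow> slope b < slope c"
  obtains A' B' C' where "A' \<subseteq> A" "B' \<subseteq> B" "C' \<subseteq> C"
    "card A \<le> 2 * card A'" "card B \<le> 2 * card B'" "card C \<le> 2 * card C'"
    "homogeneous A' B' C'"
proof (cases "A = {} \<or> B = {} \<or> C = {}")
  case True
  then show ?thesis
    using that[of A B C] unfolding homogeneous_def by auto
next
  case False
  then have ne: "A \<noteq> {}" "B \<noteq> {}" "C \<noteq> {}" by auto
  have AC: "slope a < slope c" if "a \<in> A" "c \<in> C" for a c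
    using ne(2) AB BC that by (meson all_not_in_conv less_trans)
  obtain t y where
    A: "card A \<le> 2 * card {a \<in> A. height a t \<le> y}" "card A \<le> 2 * card {a \<in> A. y \<le> height a t}" and
    C: "card C \<le> 2 * card {c \<in> C. height c t \<le> y}" "card C \<le> 2 * card {c \<in> C. y \<le> height c t}"
    by (rule common_median[OF fin(1) ne(1) fin(3) ne(3) AC])
  have "card B \<le> card {b \<in> B. y \<le> height b t} + card {b \<in> B. height b t \<le> y}"
    using fin(2) by (intro order_trans[OF card_mono card_Un_le]) auto
  then consider (above) "card B \<le> 2 * card {b \<in> B. y \<le> height b t}"
    | (below) "card B \<le> 2 * card {b \<in> B. height b t \<le> y}"
    by linarith
  then show ?thesis
  proof cases
    case above
    have "bends 1 a b c"
      if "a \<in> {a \<in> A. height a t \<le> y}" "b \<in> {b \<in> B. y \<le> height b t}" "c \<in> {c \<in> C. height c t \<le> y}"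
      for a b c
    proof -
      have "cross_abscissa a b \<le> t" "t \<le> cross_abscissa b c"
        using height_le_iff(1)[OF AB, of a b t] height_le_iff(2)[OF BC, of b c t] that by auto
      then show ?thesis unfolding bends_def by simp
    qed
    then have "homogeneous {a \<in> A. height a t \<le> y} {b \<in> B. y \<le> height b t} {c \<in> C. height c t \<le> y}"
      unfolding homogeneous_def by blast
    then show ?thesis
      using that[OF _ _ _ A(1) above C(1)] by simp
  next
    case below
    have "bends (-1) a b c"
      if "a \<in> {a \<in> A. y \<le> height a t}" "b \<in> {b \<in> B. height b t \<le> y}" "c \<in> {c \<in> C. y \<le> height c t}"
      for a b c
    proof -
      have "t \<le> cross_abscissa a b" "cross_abscissa b c \<le> t"
        using height_le_iff(2)[OF AB, of a b t] height_le_iff(1)[OF BC, of b c t] that by auto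
      then show ?thesis unfolding bends_def by simp
    qed
    then have "homogeneous {a \<in> A. y \<le> height a t} {b \<in> B. height b t \<le> y} {c \<in> C. y \<le> height c t}"
      unfolding homogeneous_def by blast
    then show ?thesis
      using that[OF _ _ _ A(2) below C(2)] by simp
  qed
qed

section \<open>Homogeneous blocks\<close>

text \<open>Homogeneity passes to subfamilies, so the triples can be treated one after another. Each of them
  halves every family at most once.\<close>

lemma refine_triples:
  fixes G :: "nat \<Rightarrow> (real^2) set set"
  assumes "finite Q" and Q: "\<And>i j k. (i, j, k) \<in> Q \<Longrightarrow> i < j \<and> j < k"
    and fin: "\<And>i. finite (G i)"
    and slopes: "\<forall>i j. i < j \<longrightarrow> (\<forall>a\<in>G i. \<forall>b\<in>G j. slope a < slope b)"
  shows "\<exists>H. (\<forall>i. H i \<subseteq> G i) \<and> (\<forall>i. card (G i) \<le> 2 ^ card Q * card (H i)) \<and>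
     (\<forall>i j k. (i, j, k) \<in> Q \<longrightarrow> homogeneous (H i) (H j) (H k))"
  using assms(1) Q
proof (induction Q)
  case empty
  then show ?case by (intro exI[of _ G]) auto
next
  case (insert q Q)
  obtain H where H: "\<And>i. H i \<subseteq> G i" "\<And>i. card (G i) \<le> 2 ^ card Q * card (H i)"
    and hom: "\<And>i j k. (i, j, k) \<in> Q \<Longrightarrow> homogeneous (H i) (H j) (H k)"
    using insert.IH[OF insert.prems[OF insertI2]] by auto
  obtain i j k where q: "q = (i, j, k)" by (cases q)
  then have ijk: "i < j" "j < k" using insert.prems by auto
  have finH: "finite (H l)" for l
    using H(1) fin finite_subset by blast
  have 1: "slope a < slope b" if "a \<in> H i" "b \<in> H j" for a b
    using slopes ijk(1) H(1) that by blast
  have 2: "slope a < slope b" if "a \<in> H j" "b \<in> H k" for a b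
    using slopes ijk(2) H(1) that by blast
  obtain A B C where sub: "A \<subseteq> H i" "B \<subseteq> H j" "C \<subseteq> H k"
    and card: "card (H i) \<le> 2 * card A" "card (H j) \<le> 2 * card B" "card (H k) \<le> 2 * card C"
    and ABC: "homogeneous A B C"
    by (rule halve_three_families[OF finH finH finH 1 2])
  define H' where "H' = H(i := A, j := B, k := C)"
  have H'ijk: "H' i = A" "H' j = B" "H' k = C"
    unfolding H'_def using ijk by auto
  have H'H: "H' l \<subseteq> H l" for l
    unfolding H'_def using sub by auto
  have half: "card (H l) \<le> 2 * card (H' l)" for l
    unfolding H'_def using card by auto
  have "card (G l) \<le> 2 ^ card (insert q Q) * card (H' l)" for l
  proof -
    have step: "2 ^ card Q * card (H l) \<le> 2 ^ card Q * (2 * card (H' l))"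
      using half by (intro mult_left_mono) auto
    then show ?thesis
      using order_trans[OF H(2)[of l] step] insert.hyps by (simp add: mult_ac)
  qed
  moreover have "H' l \<subseteq> G l" for l
    using H'H H(1) by blast
  moreover have "homogeneous (H' i') (H' j') (H' k')"
    if "(i', j', k') \<in> insert q Q" for i' j' k'
  proof (cases "(i', j', k') = q")
    case True
    then show ?thesis using ABC H'ijk q by simp
  next
    case False
    with that have "(i', j', k') \<in> Q" by blast
    from hom[OF this] H'H H'H H'H show ?thesis by (rule homogeneous_subset)
  qed
  ultimately show ?case
    by (intro exI[of _ H']) simp
qed

text \<open>A property of increasing triples is a colouring of three-element sets, which Ramsey's theorem
  handles.\<close>

lemma ramsey_increasing_triples:
  obtains M :: nat where
    "\<And>P. \<exists>I\<subseteq>{..<M}. card I = n \<and>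
       ((\<forall>i\<in>I. \<forall>j\<in>I. \<forall>k\<in>I. i < j \<longrightarrow> j < k \<longrightarrow> P i j k) \<or>
        (\<forall>i\<in>I. \<forall>j\<in>I. \<forall>k\<in>I. i < j \<longrightarrow> j < k \<longrightarrow> \<not> P i j k))"
proof -
  obtain M :: nat where M: "partn_lst {..<M} [n, n] 3"
    using ramsey_full by blast
  have "\<exists>I\<subseteq>{..<M}. card I = n \<and>
       ((\<forall>i\<in>I. \<forall>j\<in>I. \<forall>k\<in>I. i < j \<longrightarrow> j < k \<longrightarrow> P i j k) \<or>
        (\<forall>i\<in>I. \<forall>j\<in>I. \<forall>k\<in>I. i < j \<longrightarrow> j < k \<longrightarrow> \<not> P i j k))" for P
  proof -
    define f :: "nat set \<Rightarrow> nat" where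
      "f X = (if \<exists>i j k. i < j \<and> j < k \<and> X = {i, j, k} \<and> P i j k then 0 else 1)" for X
    have f: "f {i, j, k} = (if P i j k then 0 else 1)" if "i < j" "j < k" for i j k
    proof -
      have "i' = i \<and> j' = j \<and> k' = k"
        if "i' < j'" "j' < k'" "{i, j, k} = {i', j', k'}" for i' j' k'
      proof -
        have "[i, j, k] = sorted_list_of_set {i, j, k}"
          using \<open>i < j\<close> \<open>j < k\<close> by (simp add: sorted_list_of_set_insert_remove)
        also have "\<dots> = sorted_list_of_set {i', j', k'}"
          by (simp only: that(3))
        also have "\<dots> = [i', j', k']"
          using that(1,2) by (simp add: sorted_list_of_set_insert_remove)
        finally show ?thesis by simp
      qed
      then show ?thesis
        unfolding f_def using that by auto
    qed
    have "f \<in> nsets {..<M} 3 \<rightarrow> {..<length [n, n]}"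
      by (auto simp: f_def)
    then obtain c where c: "c < 2" "monochromatic {..<M} ([n, n] ! c) 3 f c"
      using M unfolding partn_lst_def by (metis One_nat_def length_Cons list.size(3) numeral_2_eq_2)
    then have "[n, n] ! c = n"
      by (auto simp: less_2_cases_iff)
    with c obtain I where I: "I \<subseteq> {..<M}" "card I = n" "f ` nsets I 3 \<subseteq> {c}"
      unfolding monochromatic_def nsets_def by auto
    have "f {i, j, k} = c" if "i \<in> I" "j \<in> I" "k \<in> I" "i < j" "j < k" for i j k
    proof -
      have "{i, j, k} \<in> nsets I 3"
        unfolding nsets_def using that by auto
      then show ?thesis using I(3) by blast
    qed
    then have "P i j k \<longleftrightarrow> c = 0" if "i \<in> I" "j \<in> I" "k \<in> I" "i < j" "j < k" for i j k
      using f that by (metis zero_neq_one)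
    with I(1,2) show ?thesis by blast
  qed
  with that show ?thesis by blast
qed

text \<open>Group the elements by rank, \<open>q\<close> consecutive ranks to a block; the remainder is discarded.\<close>

lemma ordered_blocks:
  fixes s :: "'a \<Rightarrow> real"
  assumes fin: "finite F" and inj: "inj_on s F" and size: "M * q \<le> card F"
  obtains G :: "nat \<Rightarrow> 'a set" where "\<And>i. G i \<subseteq> F" "\<And>i. i < M \<Longrightarrow> card (G i) = q"
    "\<And>i j a b. i < j \<Longrightarrow> a \<in> G i \<Longrightarrow> b \<in> G j \<Longrightarrow> s a < s b"
proof -
  define r where "r a = card {b \<in> F. s b < s a}" for a
  have mono: "r a < r b" if "a \<in> F" "s a < s b" for a b
  proof -
    have "{x \<in> F. s x < s a} \<subset> {x \<in> F. s x < s b}"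
      using that by (auto intro: less_trans)
    then show ?thesis
      unfolding r_def using fin by (intro psubset_card_mono) auto
  qed
  have "inj_on r F"
  proof (rule inj_onI, rule ccontr)
    fix a b assume "a \<in> F" "b \<in> F" "r a = r b" "a \<noteq> b"
    then show False
      using inj mono[of a b] mono[of b a] by (metis inj_onD less_irrefl linorder_neqE)
  qed
  moreover have "r ` F \<subseteq> {..<card F}"
  proof
    fix x assume "x \<in> r ` F"
    then obtain a where a: "a \<in> F" "x = r a" by blast
    then have "{b \<in> F. s b < s a} \<subset> F" by auto
    then show "x \<in> {..<card F}"
      using fin a unfolding r_def by (simp add: psubset_card_mono)
  qed
  ultimately have r: "r ` F = {..<card F}"
    by (intro card_subset_eq) (auto simp: card_image)
  define G where "G i = {a \<in> F. i * q \<le> r a \<and> r a < Suc i * q}" for i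
  show ?thesis
  proof
    show "G i \<subseteq> F" for i
      unfolding G_def by blast
    show "card (G i) = q" if "i < M" for i
    proof -
      have "Suc i * q \<le> M * q"
        using that by (intro mult_right_mono) auto
      with size have "Suc i * q \<le> card F" by linarith
      then have "{i * q..<Suc i * q} \<subseteq> r ` F"
        unfolding r by auto
      then have "{i * q..<Suc i * q} \<subseteq> r ` G i"
        unfolding G_def by fastforce
      then have "r ` G i = {i * q..<Suc i * q}"
        unfolding G_def by fastforce
      moreover have "inj_on r (G i)"
        using \<open>inj_on r F\<close> by (rule inj_on_subset) (auto simp: G_def)
      ultimately have "card (G i) = card {i * q..<Suc i * q}"
        by (metis card_image)
      then show ?thesis by simp
    qed
    show "s a < s b" if "i < j" "a \<in> G i" "b \<in> G j" for i j a b
    proof (rule ccontr)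
      assume "\<not> s a < s b"
      then have "b = a \<or> s b < s a"
        using that inj unfolding G_def by (auto simp: not_less le_less dest: inj_onD)
      then have "r b \<le> r a"
        using mono[of b a] that unfolding G_def by auto
      moreover have "Suc i * q \<le> j * q"
        using that by (intro mult_right_mono) auto
      ultimately show False
        using that unfolding G_def by auto
    qed
  qed
qed

theorem theorem6p1:
  fixes n :: nat
  assumes "n \<ge> 2"
  shows "\<exists>C::real. C > 0 \<and> (\<exists>N::nat. \<forall>\<F>::(real^2) set set.
           general_position \<F> \<and> card \<F> \<ge> N \<longrightarrow>
           (\<exists>G :: nat \<Rightarrow> (real^2) set set.
              (\<forall>i\<in>{1..n}. G i \<subseteq> \<F> \<and> real (card (G i)) \<ge> C * real (card \<F>)) \<and>
              (\<forall>T. transversal n G T \<longrightarrow> defines_cell n T)))"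
proof -
  obtain M :: nat where M: "\<And>P. \<exists>I\<subseteq>{..<M}. card I = n \<and>
       ((\<forall>i\<in>I. \<forall>j\<in>I. \<forall>k\<in>I. i < j \<longrightarrow> j < k \<longrightarrow> P i j k) \<or>
        (\<forall>i\<in>I. \<forall>j\<in>I. \<forall>k\<in>I. i < j \<longrightarrow> j < k \<longrightarrow> \<not> P i j k))"
    using ramsey_increasing_triples by blast
  have "0 < M"
    using M[of "\<lambda>_ _ _. True"] assms by (cases M) auto
  define Q where "Q = {(i, j, k). i < j \<and> j < k \<and> k < M}"
  have "Q \<subseteq> {..<M} \<times> {..<M} \<times> {..<M}"
    unfolding Q_def by auto
  then have finQ: "finite Q"
    using finite_subset by blast
  \<comment> \<open>A block has at least \<open>1 / (2 * M)\<close> of the lines, the \<open>2\<close> accounting for the remainder of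
    the division by \<open>M\<close>, and then loses at most a factor \<open>2\<close> for each of the triples.\<close>
  define C where "C = 1 / (2 * real M * 2 ^ card Q)"
  have "C > 0"
    unfolding C_def using \<open>0 < M\<close> by simp
  moreover have "\<exists>G. (\<forall>i\<in>{1..n}. G i \<subseteq> \<F> \<and> real (card (G i)) \<ge> C * real (card \<F>)) \<and>
              (\<forall>T. transversal n G T \<longrightarrow> defines_cell n T)"
    if gp: "general_position \<F>" and large: "M \<le> card \<F>" for \<F> :: "(real^2) set set"
  proof -
    define q where "q = card \<F> div M"
    have "1 \<le> q"
      unfolding q_def using large \<open>0 < M\<close> by (simp add: Suc_le_eq div_greater_zero_iff)
    have "card \<F> = M * q + card \<F> mod M"
      unfolding q_def by simp
    also have "\<dots> \<le> M * q + M * q"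
      using \<open>0 < M\<close> \<open>1 \<le> q\<close>
      by (intro add_left_mono) (metis less_imp_le mod_less_divisor mult_le_mono2 nat_mult_1_right order_trans)
    finally have q: "card \<F> \<le> 2 * M * q" by simp
    have fin: "finite \<F>"
      by (rule general_positionD(1)[OF gp])
    obtain G where G: "\<And>i. G i \<subseteq> \<F>" "\<And>i. i < M \<Longrightarrow> card (G i) = q"
      and G_slopes: "\<And>i j a b. i < j \<Longrightarrow> a \<in> G i \<Longrightarrow> b \<in> G j \<Longrightarrow> slope a < slope b"
      using ordered_blocks[OF fin general_position_slopes[OF gp], of M q] q_def
      by (metis times_div_less_eq_dividend)
    have finG: "finite (G i)" for i
      by (rule finite_subset[OF G(1) fin])
    have Q_lt: "i < j \<and> j < k" if "(i, j, k) \<in> Q" for i j k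
      using that unfolding Q_def by simp
    obtain H where H: "\<And>i. H i \<subseteq> G i" "\<And>i. card (G i) \<le> 2 ^ card Q * card (H i)"
      and hom: "\<And>i j k. (i, j, k) \<in> Q \<Longrightarrow> homogeneous (H i) (H j) (H k)"
      using refine_triples[of Q G, OF finQ Q_lt finG] G_slopes by auto
    define up where "up i j k \<longleftrightarrow> (\<forall>a\<in>H i. \<forall>b\<in>H j. \<forall>c\<in>H k. bends 1 a b c)" for i j k
    obtain I where I: "I \<subseteq> {..<M}" "card I = n" and
      "(\<forall>i\<in>I. \<forall>j\<in>I. \<forall>k\<in>I. i < j \<longrightarrow> j < k \<longrightarrow> up i j k) \<or>
       (\<forall>i\<in>I. \<forall>j\<in>I. \<forall>k\<in>I. i < j \<longrightarrow> j < k \<longrightarrow> \<not> up i j k)"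
      using M[of up] by blast
    then obtain \<sigma> :: real where \<sigma>: "\<bar>\<sigma>\<bar> = 1" and
      bends: "\<And>i j k a b c. i \<in> I \<Longrightarrow> j \<in> I \<Longrightarrow> k \<in> I \<Longrightarrow> i < j \<Longrightarrow> j < k \<Longrightarrow>
         a \<in> H i \<Longrightarrow> b \<in> H j \<Longrightarrow> c \<in> H k \<Longrightarrow> bends \<sigma> a b c"
    proof (elim disjE)
      assume *: "\<forall>i\<in>I. \<forall>j\<in>I. \<forall>k\<in>I. i < j \<longrightarrow> j < k \<longrightarrow> up i j k"
      show thesis
        using that[of 1] * unfolding up_def by (metis abs_1)
    next
      assume *: "\<forall>i\<in>I. \<forall>j\<in>I. \<forall>k\<in>I. i < j \<longrightarrow> j < k \<longrightarrow> \<not> up i j k"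
      show thesis
      proof (rule that[of "-1"])
        \<comment> \<open>Failing for one choice of lines, the upward order fails for all of them by
          homogeneity.\<close>
        fix i j k a b c
        assume ijk: "i \<in> I" "j \<in> I" "k \<in> I" "i < j" "j < k" and "a \<in> H i" "b \<in> H j" "c \<in> H k"
        have "(i, j, k) \<in> Q"
          using ijk I(1) unfolding Q_def by auto
        then have "homogeneous (H i) (H j) (H k)"
          by (rule hom)
        with * ijk show "bends (-1) a b c"
          using \<open>a \<in> H i\<close> \<open>b \<in> H j\<close> \<open>c \<in> H k\<close> unfolding up_def homogeneous_def by blast
      qed simp
    qed
    have "finite I"
      using I(1) finite_subset by blast
    then obtain h where h: "bij_betw h {1..n} I"
      using I(2) finite_same_card_bij[of "{1..n}" I] by auto
    have hI: "h i \<in> I" "h i < M" if "i \<in> {1..n}" for i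
      using h that I(1) bij_betwE by blast+
    show ?thesis
    proof (intro exI[of _ "H \<circ> h"] conjI ballI allI impI)
      fix i assume i: "i \<in> {1..n}"
      show "(H \<circ> h) i \<subseteq> \<F>"
        using H(1) G(1) by (auto simp: subset_iff)
      have "q \<le> 2 ^ card Q * card (H (h i))"
        using H(2)[of "h i"] G(2) hI[OF i] by simp
      then have "2 * M * q \<le> 2 * M * (2 ^ card Q * card (H (h i)))"
        by (intro mult_left_mono) auto
      with q have "card \<F> \<le> 2 * M * (2 ^ card Q * card (H (h i)))" by linarith
      then have "real (card \<F>) \<le> real (2 * M * (2 ^ card Q * card (H (h i))))"
        by (rule of_nat_mono)
      then show "C * real (card \<F>) \<le> real (card ((H \<circ> h) i))"
        unfolding C_def using \<open>0 < M\<close> by (simp add: field_simps)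
    next
      fix T assume "transversal n (H \<circ> h) T"
      then obtain a where a: "\<And>i. i \<in> {1..n} \<Longrightarrow> a i \<in> H (h i)" and T: "T = a ` {1..n}"
        unfolding transversal_def comp_def by blast
      have slope_lt: "slope (a i) < slope (a j)" if "i \<in> {1..n}" "j \<in> {1..n}" "h i < h j" for i j
        using G_slopes[OF that(3)] H(1) a that by blast
      have less_iff: "slope (a i) < slope (a j) \<longleftrightarrow> h i < h j" if "i \<in> {1..n}" "j \<in> {1..n}" for i j
      proof (cases "h i" "h j" rule: linorder_cases)
        case equal
        then have "i = j"
          using h that by (meson bij_betw_def inj_onD)
        then show ?thesis by simp
      qed (use slope_lt[of i j] slope_lt[of j i] that in auto)
      have "inj_on a {1..n}"
      proof (rule inj_onI)
        fix i j assume ij: "i \<in> {1..n}" "j \<in> {1..n}" "a i = a j"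
        then have "h i = h j"
          using less_iff[of i j] less_iff[of j i] by (metis less_irrefl linorder_neqE_nat)
        then show "i = j"
          using h ij by (meson bij_betw_def inj_onD)
      qed
      then have cardT: "card T = n"
        unfolding T by (simp add: card_image)
      have "T \<subseteq> \<F>"
        using a H(1) G(1) unfolding T by blast
      then have gpT: "general_position T"
        using gp general_position_subset by blast
      have "defines_cell (card T) T"
      proof (rule bending_family_defines_cell[OF gpT _ \<sigma>])
        show "2 \<le> card T" using cardT assms by simp
        fix L K N assume "L \<in> T" "K \<in> T" "N \<in> T" and lt: "slope L < slope K" "slope K < slope N"
        then obtain i j k where ijk: "i \<in> {1..n}" "j \<in> {1..n}" "k \<in> {1..n}"
          and eq: "L = a i" "K = a j" "N = a k"
          unfolding T by blast
        have "h i < h j" "h j < h k"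
          using lt less_iff ijk unfolding eq by auto
        then show "bends \<sigma> L K N"
          unfolding eq using bends a hI ijk by meson
      qed
      then show "defines_cell n T"
        unfolding cardT .
    qed
  qed
  ultimately show ?thesis by blast
qed

end
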